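(* Let $n\ge2$ and let $u,v\in\mathbb{M}_n(\mathbb{C})$ be arbitrary unitary matrices. Then $$\alpha\left(u\Delta^{(n)}u^*,v\Delta^{(n)}v^*\right)=\alpha\left(\Delta^{(n)},u^*v\Delta^{(n)}v^*u\right).$$
   Context: $\Delta^{(n)}$ denotes the algebra of diagonal matrices in $\mathbb{M}_n(\mathbb{C})$. Interior angle (taken with respect to $E_0(X)=\frac1n\operatorname{Tr}(X)\mathbb{I}_n$): view $\mathbb{M}_n(\mathbb{C})$ as a Hilbert space with inner product $\langle X,Y\rangle_\tau=\frac1n\operatorname{Tr}(X^*Y)$, and let $\mathbb{M}_n(\mathbb{C})$ act on it by left multiplication. For a unital $C^*$-subalgebra $\mathcal{C}\subseteq\mathbb{M}_n(\mathbb{C})$ let $e_{\mathcal{C}}\in\mathcal{B}(\mathbb{M}_n(\mathbb{C}))$ be the Jones projection $X\mapsto E_{\mathcal{C}}(X)$, where $E_{\mathcal{C}}$ is the trace-preserving conditional expectation onto $\mathcal{C}$ (equivalently, $e_{\mathcal{C}}$ is the orthogonal projection onto $\mathcal{C}$), and let $e_1:=e_{\mathbb{C}\mathbb{I}_n}$. Let $\tilde{E}:\mathcal{B}(\mathbb{M}_n(\mathbb{C}))\to\mathbb{M}_n(\mathbb{C})$ be the dual conditional expectation, i.e. the linear map determined by $\tilde{E}(xe_1y)=\frac1{n^2}xy$ for $x,y\in\mathbb{M}_n(\mathbb{C})$. (Identifying $A\otimes B$ with the operator $X\mapsto AXB^T$, one has $\tilde{E}(A\otimes B)=\frac1n\operatorname{Tr}(B)A$.)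 For $S,T\in\mathcal{B}(\mathbb{M}_n(\mathbb{C}))$ put $\langle S,T\rangle:=\tilde{E}(S^*T)$ and $\|S\|_{\sim}:=\|\tilde{E}(S^*S)\|^{1/2}$, with the operator norm on $\mathbb{M}_n(\mathbb{C})$. For unital $C^*$-subalgebras $\mathcal{C},\mathcal{D}\neq\mathbb{C}\mathbb{I}_n$, $\alpha(\mathcal{C},\mathcal{D})$ is the unique element of $[0,\pi/2]$ with $$\cos\alpha(\mathcal{C},\mathcal{D})=\frac{\|\langle e_{\mathcal{C}}-e_1,\,e_{\mathcal{D}}-e_1\rangle\|}{\|e_{\mathcal{C}}-e_1\|_{\sim}\,\|e_{\mathcal{D}}-e_1\|_{\sim}}.$$ *)

theory Defs
  imports "HOL-Analysis.Analysis"
begin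

section \<open>Complex matrices\<close>

text \<open>The index type \<open>'n\<close> has \<open>n = CARD('n)\<close> elements. The HOL-Analysis scaling \<open>*s\<close> does not
  scale a matrix by a complex number, hence \<open>cscale\<close>.\<close>

type_synonym 'n cmat = "complex ^ 'n ^ 'n"

definition cscale :: "complex \<Rightarrow> 'n::finite cmat \<Rightarrow> 'n cmat" where
  "cscale c A = map_matrix ((*) c) A"

definition mstar :: "'n::finite cmat \<Rightarrow> 'n cmat" where
  "mstar A = map_matrix cnj (transpose A)"

definition unitary_matrix :: "'n::finite cmat \<Rightarrow> bool" where
  "unitary_matrix u \<longleftrightarrow> mstar u ** u = mat 1 \<and> u ** mstar u = mat 1"

definition mnorm :: "'n::finite cmat \<Rightarrow> real" where
  "mnorm A = onorm ((*v) A)"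

definition diag_alg :: "'n::finite cmat set" where
  "diag_alg = {A. \<forall>i j. i \<noteq> j \<longrightarrow> A $ i $ j = 0}"

definition scalar_alg :: "'n::finite cmat set" where
  "scalar_alg = range mat"

text \<open>Norm-closedness is automatic in finite dimension.\<close>

definition unital_cstar_subalgebra :: "'n::finite cmat set \<Rightarrow> bool" where
  "unital_cstar_subalgebra C \<longleftrightarrow> mat 1 \<in> C \<and>
     (\<forall>A\<in>C. \<forall>B\<in>C. A + B \<in> C \<and> A ** B \<in> C) \<and>
     (\<forall>A\<in>C. mstar A \<in> C \<and> (\<forall>c. cscale c A \<in> C))"

section \<open>Conditional expectations and operators on the Hilbert space of matrices\<close>

definition is_cond_exp :: "'n::finite cmat set \<Rightarrow> ('n cmat \<Rightarrow> 'n cmat) \<Rightarrow> bool" where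
  "is_cond_exp C E \<longleftrightarrow>
     Vector_Spaces.linear cscale cscale E \<and>
     (\<forall>X. E X \<in> C) \<and> (\<forall>X\<in>C. E X = X) \<and>
     (\<forall>A\<in>C. \<forall>B\<in>C. \<forall>X. E (A ** X ** B) = A ** E X ** B) \<and>
     (\<forall>X. \<exists>Y. E (mstar X ** X) = mstar Y ** Y) \<and>
     (\<forall>X. trace (E X) = trace X)"

text \<open>The conditional expectation onto \<open>C\<close>; as an operator on the Hilbert space of matrices
  it is the Jones projection of \<open>C\<close>.\<close>

definition jones :: "'n::finite cmat set \<Rightarrow> 'n cmat \<Rightarrow> 'n cmat" where
  "jones C = (THE E. is_cond_exp C E)"

abbreviation jones1 :: "'n::finite cmat \<Rightarrow> 'n cmat" where
  "jones1 \<equiv> jones scalar_alg"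

definition tau_inner :: "'n::finite cmat \<Rightarrow> 'n cmat \<Rightarrow> complex" where
  "tau_inner X Y = trace (mstar X ** Y) / of_nat CARD('n)"

definition operators :: "('n::finite cmat \<Rightarrow> 'n cmat) set" where
  "operators = {T. Vector_Spaces.linear cscale cscale T}"

definition op_star :: "('n::finite cmat \<Rightarrow> 'n cmat) \<Rightarrow> 'n cmat \<Rightarrow> 'n cmat" where
  "op_star S = (THE T. \<forall>X Y. tau_inner (S X) Y = tau_inner X (T Y))"

text \<open>Matrices act by left multiplication, so \<open>x e\<^sub>1 y\<close> is the operator
  \<open>X \<mapsto> x e\<^sub>1(y X)\<close>. Membership in \<open>extensional operators\<close> only fixes the irrelevant values
  at functions that are not linear operators.\<close>

definition is_dual_cond_exp :: "(('n::finite cmat \<Rightarrow> 'n cmat) \<Rightarrow> 'n cmat) \<Rightarrow> bool" where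
  "is_dual_cond_exp F \<longleftrightarrow>
     F \<in> extensional operators \<and>
     (\<forall>S\<in>operators. \<forall>T\<in>operators. F (\<lambda>X. S X + T X) = F S + F T) \<and>
     (\<forall>c. \<forall>T\<in>operators. F (\<lambda>X. cscale c (T X)) = cscale c (F T)) \<and>
     (\<forall>x y. F (\<lambda>X. x ** jones1 (y ** X)) = cscale (1 / (of_nat CARD('n))\<^sup>2) (x ** y))"

definition dual_cond_exp :: "('n::finite cmat \<Rightarrow> 'n cmat) \<Rightarrow> 'n cmat" where
  "dual_cond_exp = (THE F. is_dual_cond_exp F)"

section \<open>The interior angle\<close>

definition op_inner :: "('n::finite cmat \<Rightarrow> 'n cmat) \<Rightarrow> ('n cmat \<Rightarrow> 'n cmat) \<Rightarrow> 'n cmat" where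
  "op_inner S T = dual_cond_exp (op_star S \<circ> T)"

definition op_norm :: "('n::finite cmat \<Rightarrow> 'n cmat) \<Rightarrow> real" where
  "op_norm S = sqrt (mnorm (op_inner S S))"

text \<open>Meaningful for unital \<open>C\<^sup>*\<close>-subalgebras different from \<open>scalar_alg\<close>.\<close>

definition interior_angle :: "'n::finite cmat set \<Rightarrow> 'n cmat set \<Rightarrow> real" where
  "interior_angle C D =
     (let eC = (\<lambda>X. jones C X - jones1 X); eD = (\<lambda>X. jones D X - jones1 X)
      in THE a. a \<in> {0..pi / 2} \<and>
           cos a = mnorm (op_inner eC eD) / (op_norm eC * op_norm eD))"

section \<open>Well-definedness\<close>

lemma mstar_nth [simp]: "mstar A $ i $ j = cnj (A $ j $ i)"
  by (simp add: mstar_def transpose_def)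

lemma cscale_nth [simp]: "cscale c A $ i $ j = c * A $ i $ j"
  by (simp add: cscale_def)

lemma vector_space_cscale: "vector_space (cscale :: complex \<Rightarrow> 'n::finite cmat \<Rightarrow> _)"
  by unfold_locales (simp_all add: vec_eq_iff algebra_simps)

lemma linear_cscale_iff:
  "Vector_Spaces.linear cscale cscale f \<longleftrightarrow>
     (\<forall>X Y. f (X + Y) = f X + f Y) \<and> (\<forall>c X. f (cscale c X) = cscale c (f X))"
  by (simp add: Vector_Spaces.linear_iff vector_space_cscale)

lemma mult_mat_left: "mat c ** (A :: 'n::finite cmat) = cscale c A"
  by (simp add: vec_eq_iff matrix_matrix_mult_def mat_def if_distrib[of "\<lambda>x. x * _"] cong: if_cong)

lemma mult_mat_right: "A ** mat c = cscale c (A :: 'n::finite cmat)"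
  by (simp add: vec_eq_iff matrix_matrix_mult_def mat_def if_distrib[of "\<lambda>x. _ * x"] cong: if_cong)

lemma cscale_mat: "cscale a (mat b) = mat (a * b)"
  by (simp add: vec_eq_iff mat_def)

lemma cscale_mult: "cscale c A ** B = cscale c (A ** B)" "A ** cscale c B = cscale c (A ** B)"
  by (simp_all add: vec_eq_iff matrix_matrix_mult_def sum_distrib_left mult_ac)

lemma cscale_cscale: "cscale a (cscale b A) = cscale (a * b) A"
  by (simp add: vec_eq_iff)

lemma trace_cscale: "trace (cscale c A) = c * trace A"
  by (simp add: trace_def sum_distrib_left)

lemma trace_mult_eq: "trace (A ** B) = (\<Sum>i\<in>UNIV. \<Sum>j\<in>UNIV. A $ i $ j * B $ j $ i)"
  by (simp add: trace_def matrix_matrix_mult_def)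

lemma trace_mstar_self:
  "trace (mstar A ** A) = of_real (\<Sum>i\<in>UNIV. \<Sum>j\<in>UNIV. (cmod (A $ j $ i))\<^sup>2)"
  by (simp only: trace_mult_eq mstar_nth of_real_sum complex_norm_square mult.commute)

lemma trace_mstar_self_eq_0: "trace (mstar A ** A) = 0 \<Longrightarrow> A = 0"
  unfolding trace_mstar_self of_real_eq_0_iff
  by (simp add: sum_nonneg_eq_0_iff sum_nonneg vec_eq_iff)

lemma is_cond_exp_unique:
  assumes C: "unital_cstar_subalgebra C" and E: "is_cond_exp C E" and F: "is_cond_exp C F"
  shows "E = F"
proof
  fix X
  have one: "mat 1 \<in> C" using C by (simp add: unital_cstar_subalgebra_def)
  have *: "trace (A ** G X) = trace (A ** X)" if "is_cond_exp C G" "A \<in> C" for A G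
  proof -
    have "G (A ** X ** mat 1) = A ** G X ** mat 1" "trace (G (A ** X)) = trace (A ** X)"
      using that one unfolding is_cond_exp_def by blast+
    then show ?thesis by simp
  qed
  define D where "D = E X - F X"
  have "E X \<in> C" "F X \<in> C" using E F unfolding is_cond_exp_def by blast+
  moreover have "D = E X + cscale (-1) (F X)" by (simp add: D_def vec_eq_iff)
  ultimately have "mstar D \<in> C" using C by (simp add: unital_cstar_subalgebra_def)
  then have "trace (mstar D ** E X) = trace (mstar D ** F X)" using * E F by metis
  then have "trace (mstar D ** D) = 0"
    by (simp add: D_def trace_mult_eq right_diff_distrib sum_subtractf)
  then show "E X = F X" using trace_mstar_self_eq_0 D_def by fastforce
qed

lemma unital_cstar_subalgebra_scalar: "unital_cstar_subalgebra (scalar_alg :: 'n::finite cmat set)"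
proof -
  have "mat a + mat b = (mat (a + b) :: 'n cmat)" "mat a ** mat b = (mat (a * b) :: 'n cmat)"
    "mstar (mat a) = (mat (cnj a) :: 'n cmat)" "cscale a (mat b) = (mat (a * b) :: 'n cmat)" for a b
    by (simp_all only: mult_mat_left cscale_mat) (simp_all add: vec_eq_iff mat_def)
  then show ?thesis
    unfolding unital_cstar_subalgebra_def scalar_alg_def by (auto simp del: cscale_nth)
qed

lemma jones1_eq: "jones1 (X :: 'n::finite cmat) = mat (trace X / of_nat CARD('n))"
proof -
  define E where "E = (\<lambda>X :: 'n cmat. mat (trace X / of_nat CARD('n)) :: 'n cmat)"
  have "\<exists>Y. E (mstar X ** X) = mstar Y ** Y" for X
  proof -
    define r where "r = (\<Sum>i\<in>UNIV. \<Sum>j\<in>UNIV. (cmod (X $ j $ i))\<^sup>2) / CARD('n)"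
    have "r \<ge> 0" by (simp add: r_def sum_nonneg)
    have "E (mstar X ** X) = mat (of_real r)" by (simp add: E_def trace_mstar_self r_def)
    also have "\<dots> = mstar (mat (of_real (sqrt r))) ** mat (of_real (sqrt r))"
      using \<open>r \<ge> 0\<close> by (simp only: mult_mat_right cscale_cscale) (auto simp: vec_eq_iff mat_def simp flip: of_real_mult)
    finally show ?thesis by blast
  qed
  moreover have "Vector_Spaces.linear cscale cscale E"
    by (auto simp: linear_cscale_iff E_def vec_eq_iff mat_def trace_def sum.distrib
        sum_distrib_left add_divide_distrib)
  moreover have "E (mat a ** X ** mat b) = mat a ** E X ** mat b" for a b X
    by (simp add: E_def mult_mat_left mult_mat_right cscale_mat trace_cscale mult_ac)
  moreover have "trace (E X) = trace X" "E (mat a) = mat a" for a X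
    by (simp_all add: E_def trace_def mat_def vec_eq_iff)
  ultimately have "is_cond_exp scalar_alg E"
    unfolding is_cond_exp_def by (auto simp: scalar_alg_def E_def)
  then have "jones1 = E"
    unfolding jones_def by (blast intro: is_cond_exp_unique[OF unital_cstar_subalgebra_scalar])
  then show ?thesis by (simp add: E_def)
qed

definition munit :: "'n \<Rightarrow> 'n \<Rightarrow> 'n::finite cmat" where
  "munit i j = (\<chi> k l. if k = i \<and> l = j then 1 else 0)"

lemma munit_nth: "munit i j $ k $ l = (if k = i then if l = j then 1 else 0 else 0)"
  by (simp add: munit_def)

lemma munit_expand: "X = (\<Sum>i\<in>UNIV. \<Sum>j\<in>UNIV. cscale (X $ i $ j) (munit i j))"
proof -
  have "(\<Sum>j\<in>UNIV. X $ i $ j * munit i j $ k $ l) = (if k = i then X $ i $ l else 0)" for i k l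
    by (cases "k = i") (simp_all add: munit_nth if_distrib[of "\<lambda>x. _ * x"] cong: if_cong)
  then show ?thesis by (simp add: vec_eq_iff)
qed

lemma operators_sum:
  assumes "T \<in> operators"
  shows "T (\<Sum>i\<in>I. f i) = (\<Sum>i\<in>I. T (f i))" "T (cscale c X) = cscale c (T X)"
proof -
  have a: "T (X + Y) = T X + T Y" and c: "T (cscale c X) = cscale c (T X)" for X Y c
    using assms by (simp_all add: operators_def linear_cscale_iff)
  have "T 0 = 0" using a[of 0 0] by simp
  then show "T (\<Sum>i\<in>I. f i) = (\<Sum>i\<in>I. T (f i))"
    by (induction I rule: infinite_finite_induct) (simp_all add: a)
  show "T (cscale c X) = cscale c (T X)" by (rule c)
qed

lemma operator_expand:
  assumes "T \<in> operators"
  shows "T X = (\<Sum>i\<in>UNIV. \<Sum>j\<in>UNIV. cscale (X $ i $ j) (T (munit i j)))"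
  by (subst munit_expand) (simp only: operators_sum[OF assms])

lemma operators_simple: "(\<lambda>X. x ** jones1 (y ** X)) \<in> operators"
  by (simp add: operators_def linear_cscale_iff jones1_eq mult_mat_right cscale_mult trace_cscale
      matrix_add_ldistrib trace_add cscale_cscale)
     (simp add: vec_eq_iff algebra_simps add_divide_distrib)

lemma operators_zero: "(\<lambda>X. 0) \<in> operators"
  and operators_add: "S \<in> operators \<Longrightarrow> T \<in> operators \<Longrightarrow> (\<lambda>X. S X + T X) \<in> operators"
  and operators_scale: "T \<in> operators \<Longrightarrow> (\<lambda>X. cscale c (T X)) \<in> operators"
  by (auto simp: operators_def linear_cscale_iff vec_eq_iff algebra_simps)

lemma trace_munit_mult: "trace (munit j i ** X) = X $ i $ j"
proof -
  have "(\<Sum>l\<in>UNIV. munit j i $ k $ l * X $ l $ k) = (if k = j then X $ i $ j else 0)" for k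
    by (cases "k = j") (simp_all add: munit_nth if_distrib[of "\<lambda>x. x * _"] cong: if_cong)
  then show ?thesis by (simp add: trace_mult_eq)
qed

lemma operators_sum_closed:
  assumes "\<And>i. i \<in> I \<Longrightarrow> T i \<in> operators"
  shows "(\<lambda>X. \<Sum>i\<in>I. T i X) \<in> operators"
  using assms
  by (induction I rule: infinite_finite_induct) (simp_all add: operators_zero operators_add)

lemma is_dual_cond_exp_sum:
  assumes F: "is_dual_cond_exp F" and "\<And>i. i \<in> I \<Longrightarrow> T i \<in> operators"
  shows "F (\<lambda>X. \<Sum>i\<in>I. T i X) = (\<Sum>i\<in>I. F (T i))"
proof -
  have add: "F (\<lambda>X. S X + T X) = F S + F T" if "S \<in> operators" "T \<in> operators" for S T
    using F that by (simp add: is_dual_cond_exp_def)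
  have "F (\<lambda>X. 0) = 0" using add[OF operators_zero operators_zero] by simp
  then show ?thesis using assms(2)
    by (induction I rule: infinite_finite_induct) (simp_all add: add operators_sum_closed)
qed

lemma is_dual_cond_exp_eq:
  fixes F :: "('n::finite cmat \<Rightarrow> 'n cmat) \<Rightarrow> 'n cmat"
  assumes F: "is_dual_cond_exp F" and T: "T \<in> operators"
  shows "F T = cscale (1 / of_nat CARD('n)) (\<Sum>i\<in>UNIV. \<Sum>j\<in>UNIV. T (munit i j) ** munit j i)"
proof -
  define S where "S = (\<lambda>i j X. cscale (of_nat CARD('n)) (T (munit i j) ** jones1 (munit j i ** X)))"
  have S: "S i j \<in> operators" for i j
    unfolding S_def by (intro operators_scale operators_simple)
  have "T = (\<lambda>X. \<Sum>i\<in>UNIV. \<Sum>j\<in>UNIV. S i j X)"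
  proof
    fix X
    have "S i j X = cscale (X $ i $ j) (T (munit i j))" for i j
      by (simp add: S_def jones1_eq mult_mat_right trace_munit_mult vec_eq_iff)
    then show "T X = (\<Sum>i\<in>UNIV. \<Sum>j\<in>UNIV. S i j X)"
      by (simp only: operator_expand[OF T, of X])
  qed
  then have "F T = F (\<lambda>X. \<Sum>i\<in>UNIV. \<Sum>j\<in>UNIV. S i j X)" by (rule arg_cong)
  also have "\<dots> = (\<Sum>i\<in>UNIV. \<Sum>j\<in>UNIV. F (S i j))"
    by (simp add: is_dual_cond_exp_sum[OF F] operators_sum_closed S)
  also have "\<dots> = (\<Sum>i\<in>UNIV. \<Sum>j\<in>UNIV. cscale (1 / of_nat CARD('n)) (T (munit i j) ** munit j i))"
  proof (intro sum.cong refl)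
    fix i j
    have hom: "F (\<lambda>X. cscale c (U X)) = cscale c (F U)" if "U \<in> operators" for c U
      using F that by (simp add: is_dual_cond_exp_def)
    have "F (S i j) = cscale (of_nat CARD('n)) (F (\<lambda>X. T (munit i j) ** jones1 (munit j i ** X)))"
      unfolding S_def by (rule hom[OF operators_simple])
    also have "\<dots> = cscale (of_nat CARD('n)) (cscale (1 / (of_nat CARD('n))\<^sup>2) (T (munit i j) ** munit j i))"
      using F by (simp add: is_dual_cond_exp_def)
    finally show "F (S i j) = cscale (1 / of_nat CARD('n)) (T (munit i j) ** munit j i)"
      by (simp add: vec_eq_iff power2_eq_square)
  qed
  finally show ?thesis by (simp add: vec_eq_iff sum_distrib_left)
qed

lemma matrix_mult_sum_right: "x ** (\<Sum>i\<in>I. f i) = (\<Sum>i\<in>I. x ** (f i :: 'n::finite cmat))"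
  by (induction I rule: infinite_finite_induct)
     (simp_all add: matrix_add_ldistrib matrix_matrix_mult_def vec_eq_iff sum.distrib algebra_simps)

lemma is_dual_cond_exp_exists:
  "\<exists>F :: ('n::finite cmat \<Rightarrow> 'n cmat) \<Rightarrow> 'n cmat. is_dual_cond_exp F"
proof
  let ?G = "\<lambda>T. cscale (1 / of_nat CARD('n)) (\<Sum>i\<in>UNIV. \<Sum>j\<in>UNIV. T (munit i j) ** munit j i) :: 'n cmat"
  have "?G (\<lambda>X. x ** jones1 (y ** X)) = cscale (1 / (of_nat CARD('n))\<^sup>2) (x ** y)" for x y
  proof -
    have t: "trace (y ** munit i j) = y $ j $ i" for i j
      by (metis trace_mul_sym trace_munit_mult)
    have "x ** jones1 (y ** munit i j) ** munit j i =
        cscale (1 / of_nat CARD('n)) (x ** cscale (y $ j $ i) (munit j i))" for i j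
      by (simp add: jones1_eq mult_mat_right t cscale_mult cscale_cscale)
    then have "?G (\<lambda>X. x ** jones1 (y ** X)) =
        cscale (1 / (of_nat CARD('n))\<^sup>2) (\<Sum>i\<in>UNIV. \<Sum>j\<in>UNIV. x ** cscale (y $ j $ i) (munit j i))"
      by (simp add: vec_eq_iff sum_distrib_left power2_eq_square)
    also have "(\<Sum>i\<in>UNIV. \<Sum>j\<in>UNIV. x ** cscale (y $ j $ i) (munit j i)) =
        x ** (\<Sum>j\<in>UNIV. \<Sum>i\<in>UNIV. cscale (y $ j $ i) (munit j i))"
      by (subst sum.swap) (simp only: matrix_mult_sum_right)
    finally show ?thesis by (simp only: munit_expand[of y, symmetric])
  qed
  then show "is_dual_cond_exp (restrict ?G operators)"
    by (simp add: is_dual_cond_exp_def operators_add operators_scale operators_simple)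
       (simp add: vec_eq_iff matrix_matrix_mult_def sum_distrib_left sum.distrib algebra_simps
          add_divide_distrib)
qed

lemma is_dual_cond_exp_dual_cond_exp:
  "is_dual_cond_exp (dual_cond_exp :: ('n::finite cmat \<Rightarrow> 'n cmat) \<Rightarrow> 'n cmat)"
proof -
  have "F = G" if F: "is_dual_cond_exp F" and G: "is_dual_cond_exp G"
    for F G :: "('n cmat \<Rightarrow> 'n cmat) \<Rightarrow> 'n cmat"
  proof (rule extensionalityI)
    show "F \<in> extensional operators" "G \<in> extensional operators"
      using F G by (simp_all add: is_dual_cond_exp_def)
  qed (simp add: is_dual_cond_exp_eq[OF F] is_dual_cond_exp_eq[OF G])
  then have "\<exists>!F :: ('n cmat \<Rightarrow> 'n cmat) \<Rightarrow> 'n cmat. is_dual_cond_exp F"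
    using is_dual_cond_exp_exists by blast
  then show ?thesis unfolding dual_cond_exp_def by (rule theI')
qed

lemma sum_swap4:
  "(\<Sum>k\<in>A. \<Sum>l\<in>B. \<Sum>i\<in>C. \<Sum>j\<in>D. f k l i j) = (\<Sum>j\<in>D. \<Sum>i\<in>C. \<Sum>k\<in>A. \<Sum>l\<in>B. f k l i j)"
proof -
  have "(\<Sum>k\<in>A. \<Sum>l\<in>B. \<Sum>i\<in>C. \<Sum>j\<in>D. f k l i j) = (\<Sum>k\<in>A. \<Sum>i\<in>C. \<Sum>j\<in>D. \<Sum>l\<in>B. f k l i j)"
    by (rule sum.cong[OF refl], subst sum.swap, intro sum.cong[OF refl] sum.swap)
  also have "\<dots> = (\<Sum>i\<in>C. \<Sum>j\<in>D. \<Sum>k\<in>A. \<Sum>l\<in>B. f k l i j)"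
    by (subst sum.swap, intro sum.cong[OF refl] sum.swap)
  also have "\<dots> = (\<Sum>j\<in>D. \<Sum>i\<in>C. \<Sum>k\<in>A. \<Sum>l\<in>B. f k l i j)"
    by (rule sum.swap)
  finally show ?thesis .
qed

lemma op_star_adjoint:
  fixes S :: "'n::finite cmat \<Rightarrow> 'n cmat"
  assumes S: "S \<in> operators"
  shows "tau_inner (S X) Y = tau_inner X (op_star S Y)"
proof -
  define T where "T = (\<lambda>Y. \<chi> i j. trace (mstar (S (munit i j)) ** Y))"
  have T: "tau_inner (S X) Y = tau_inner X (T Y)" for X Y
  proof -
    have "trace (mstar (S X) ** Y) =
        (\<Sum>k\<in>UNIV. \<Sum>l\<in>UNIV. \<Sum>i\<in>UNIV. \<Sum>j\<in>UNIV.
           cnj (X $ i $ j) * (cnj (S (munit i j) $ l $ k) * Y $ l $ k))"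
      by (subst operator_expand[OF S])
         (simp add: trace_mult_eq sum_distrib_right mult.assoc)
    also have "\<dots> = (\<Sum>j\<in>UNIV. \<Sum>i\<in>UNIV. cnj (X $ i $ j) * T Y $ i $ j)"
      by (subst sum_swap4) (simp add: T_def trace_mult_eq sum_distrib_left)
    finally show ?thesis by (simp add: tau_inner_def trace_mult_eq)
  qed
  have "op_star S = T"
    unfolding op_star_def
  proof (rule the_equality)
    fix U assume U: "\<forall>X Y. tau_inner (S X) Y = tau_inner X (U Y)"
    show "U = T"
    proof
      fix Y
      have "tau_inner (munit i j) (U Y) = tau_inner (munit i j) (T Y)" for i j
        using T U by simp
      moreover have "tau_inner (munit i j) Z = Z $ i $ j / of_nat CARD('n)" for i j :: 'n and Z
      proof -
        have "mstar (munit i j) = munit j i" by (auto simp: vec_eq_iff munit_def)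
        then show ?thesis by (simp add: tau_inner_def trace_munit_mult)
      qed
      ultimately show "U Y = T Y" by (simp add: vec_eq_iff)
    qed
  qed (simp add: T)
  then show ?thesis using T by simp
qed

lemma mstar_mult: "mstar (A ** B) = mstar B ** mstar A"
  by (simp add: vec_eq_iff matrix_matrix_mult_def mult.commute)

lemma mstar_mstar: "mstar (mstar A) = A"
  by (simp add: vec_eq_iff)

lemma unital_cstar_subalgebra_diag: "unital_cstar_subalgebra (diag_alg :: 'n::finite cmat set)"
proof -
  have "(A ** B) $ i $ j = 0" if "A \<in> diag_alg" "B \<in> diag_alg" "i \<noteq> j" for A B :: "'n cmat" and i j
    using that unfolding matrix_matrix_mult_def diag_alg_def
    by (simp, intro sum.neutral) (metis mult_eq_0_iff)
  then show ?thesis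
    by (auto simp: unital_cstar_subalgebra_def diag_alg_def mat_def)
qed

lemma unital_cstar_subalgebra_conj:
  assumes u: "unitary_matrix u" and C: "unital_cstar_subalgebra C"
  shows "unital_cstar_subalgebra ((\<lambda>d. u ** d ** mstar u) ` C)" (is "_ (?f ` C)")
proof -
  have uu: "mstar u ** u = mat 1" "u ** mstar u = mat 1"
    using u by (simp_all add: unitary_matrix_def)
  have "?f a ** ?f b = ?f (a ** b)" for a b
  proof -
    have "?f a ** ?f b = u ** a ** (mstar u ** u) ** b ** mstar u"
      by (simp only: matrix_mul_assoc)
    then show ?thesis by (simp add: uu matrix_mul_assoc)
  qed
  moreover have "?f a + ?f b = ?f (a + b)" for a b
    by (simp add: matrix_add_ldistrib vec_eq_iff matrix_matrix_mult_def sum.distrib algebra_simps)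
  moreover have "mstar (?f a) = ?f (mstar a)" "cscale c (?f a) = ?f (cscale c a)" for a c
    by (simp_all add: mstar_mult mstar_mstar matrix_mul_assoc cscale_mult)
  moreover have "mat 1 \<in> ?f ` C"
    using C by (intro image_eqI[of _ _ "mat 1"]) (simp_all add: uu unital_cstar_subalgebra_def)
  ultimately show ?thesis
    using C unfolding unital_cstar_subalgebra_def by (simp add: image_iff) blast
qed

lemma conj_diag_neq_scalar:
  fixes u :: "'n::finite cmat"
  assumes n: "CARD('n) \<ge> 2" and u: "unitary_matrix u"
  shows "(\<lambda>d. u ** d ** mstar u) ` diag_alg \<noteq> scalar_alg"
proof
  assume *: "(\<lambda>d. u ** d ** mstar u) ` diag_alg = scalar_alg"
  have uu: "mstar u ** u = mat 1" using u by (simp add: unitary_matrix_def)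
  obtain i j :: 'n where "i \<noteq> j"
    using n by (metis One_nat_def UNIV_I card_le_Suc0_iff_eq finite not_less_eq_eq numeral_2_eq_2)
  have "munit i i \<in> diag_alg" by (simp add: diag_alg_def munit_def)
  then obtain c where "u ** munit i i ** mstar u = mat c"
    using * unfolding scalar_alg_def by blast
  then have "(mstar u ** u) ** munit i i ** (mstar u ** u) = mstar u ** mat c ** u"
    by (metis matrix_mul_assoc)
  moreover have "cscale 1 A = A" for A :: "'n cmat" by (simp add: vec_eq_iff)
  ultimately have "munit i i = (mat c :: 'n cmat)"
    by (simp add: uu mult_mat_right cscale_mult cscale_mat)
  then have "munit i i $ i $ i = (mat c :: 'n cmat) $ i $ i" "munit i i $ j $ j = (mat c :: 'n cmat) $ j $ j"
    by simp_all
  then show False using \<open>i \<noteq> j\<close> by (simp add: munit_def mat_def)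
qed

end

(* Every ingredient of the interior angle is equivariant under the unitary conjugation
   X \<mapsto> u X u\<^sup>*, which preserves the normalised trace: conditional expectations and
   adjoints by uniqueness, the dual conditional expectation because its defining
   property is carried to itself. Since the operator norm is unitarily invariant, conjugating both
   algebras leaves the angle unchanged, and the theorem is conjugation of the right-hand pair
   by u. The one existence question is that of the conditional expectation onto the diagonal
   matrices, which takes diagonal parts. *)
theory Submission
  imports Defs
begin

section \<open>Unitary conjugation of matrices and of operators on matrices\<close>

definition conj_by :: "'n::finite cmat \<Rightarrow> 'n cmat \<Rightarrow> 'n cmat" where
  "conj_by u X = u ** X ** mstar u"

text \<open>For unitary \<open>u\<close> this is the conjugate of \<open>T\<close> by the invertible
  map \<open>conj_by u\<close>, whose inverse is \<open>conj_by (mstar u)\<close>.\<close>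

definition conj_op :: "'n::finite cmat \<Rightarrow> ('n cmat \<Rightarrow> 'n cmat) \<Rightarrow> 'n cmat \<Rightarrow> 'n cmat" where
  "conj_op u T X = conj_by u (T (conj_by (mstar u) X))"

lemma unitary_matrix_mstar: "unitary_matrix u \<Longrightarrow> unitary_matrix (mstar u)"
  by (simp add: unitary_matrix_def mstar_mstar)

lemma unitary_matrix_mult:
  assumes "unitary_matrix u" "unitary_matrix v"
  shows "unitary_matrix (u ** v)"
proof -
  have "mstar (u ** v) ** (u ** v) = mstar v ** (mstar u ** u) ** v"
    "(u ** v) ** mstar (u ** v) = u ** (v ** mstar v) ** mstar u"
    by (simp_all only: mstar_mult matrix_mul_assoc)
  then show ?thesis using assms by (simp add: unitary_matrix_def)
qed

lemma conj_by_conj_by: "conj_by u (conj_by v X) = conj_by (u ** v) X"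
  by (simp add: conj_by_def mstar_mult matrix_mul_assoc)

lemma conj_by_inverse [simp]:
  fixes u :: "'n::finite cmat"
  assumes "unitary_matrix u"
  shows "conj_by u (conj_by (mstar u) X) = X" "conj_by (mstar u) (conj_by u X) = X"
proof -
  have "conj_by (mat 1) X = X" for X :: "'n cmat"
  proof -
    have "mstar (mat 1) = (mat 1 :: 'n cmat)" by (simp add: vec_eq_iff mat_def)
    then show ?thesis by (simp add: conj_by_def)
  qed
  then show "conj_by u (conj_by (mstar u) X) = X" "conj_by (mstar u) (conj_by u X) = X"
    using assms by (simp_all add: conj_by_conj_by unitary_matrix_def)
qed

lemma conj_by_mult:
  assumes "unitary_matrix u"
  shows "conj_by u A ** conj_by u B = conj_by u (A ** B)"
proof -
  have "conj_by u A ** conj_by u B = u ** A ** (mstar u ** u) ** B ** mstar u"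
    by (simp only: conj_by_def matrix_mul_assoc)
  moreover have "mstar u ** u = mat 1" using assms by (simp add: unitary_matrix_def)
  ultimately show ?thesis by (simp add: conj_by_def matrix_mul_assoc)
qed

lemma conj_by_add: "conj_by u (A + B) = conj_by u A + conj_by u B"
  by (simp add: conj_by_def vec_eq_iff matrix_matrix_mult_def sum.distrib algebra_simps)

lemma conj_by_cscale: "conj_by u (cscale c A) = cscale c (conj_by u A)"
  by (simp add: conj_by_def cscale_mult)

lemma conj_by_diff: "conj_by u (A - B) = conj_by u A - conj_by u B"
  using conj_by_add[of u "A - B" B] by simp

lemma mstar_conj_by: "mstar (conj_by u A) = conj_by u (mstar A)"
  by (simp add: conj_by_def mstar_mult mstar_mstar matrix_mul_assoc)

lemma trace_conj_by:
  assumes "unitary_matrix u"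
  shows "trace (conj_by u A) = trace A"
proof -
  have "trace (conj_by u A) = trace (mstar u ** u ** A)"
    unfolding conj_by_def by (subst trace_mul_sym) (simp only: matrix_mul_assoc)
  then show ?thesis using assms by (simp add: unitary_matrix_def)
qed

lemma conj_by_mat: "unitary_matrix u \<Longrightarrow> conj_by u (mat c) = mat c"
  by (simp add: conj_by_def mult_mat_right cscale_mult unitary_matrix_def cscale_mat)

lemma conj_op_operators:
  assumes "T \<in> operators"
  shows "conj_op u T \<in> operators"
  using assms
  by (simp add: operators_def linear_cscale_iff conj_op_def conj_by_add conj_by_cscale)

lemma conj_op_comp:
  assumes "unitary_matrix u"
  shows "conj_op u S \<circ> conj_op u T = conj_op u (S \<circ> T)"
  using assms by (simp add: conj_op_def fun_eq_iff)

section \<open>Conditional expectations under conjugation\<close>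

lemma is_cond_exp_conj:
  assumes u: "unitary_matrix u" and E: "is_cond_exp C E"
  shows "is_cond_exp (conj_by u ` C) (conj_op u E)"
proof -
  note u' = unitary_matrix_mstar[OF u]
  have lin: "E \<in> operators" and in_C: "E X \<in> C" and id: "X \<in> C \<Longrightarrow> E X = X"
    and bimod: "A \<in> C \<Longrightarrow> B \<in> C \<Longrightarrow> E (A ** X ** B) = A ** E X ** B"
    and pos: "\<exists>Y. E (mstar X ** X) = mstar Y ** Y" and tr: "trace (E X) = trace X" for X A B
    using E unfolding is_cond_exp_def operators_def by blast+
  have "conj_op u E (conj_by u A ** X ** conj_by u B) = conj_by u A ** conj_op u E X ** conj_by u B"
    if "A \<in> C" "B \<in> C" for A B X
    using that by (simp add: conj_op_def u bimod conj_by_mult[OF u, symmetric]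
        conj_by_mult[OF u', symmetric])
  moreover have "\<exists>Y. conj_op u E (mstar X ** X) = mstar Y ** Y" for X
  proof -
    obtain Y where Y: "E (mstar (conj_by (mstar u) X) ** conj_by (mstar u) X) = mstar Y ** Y"
      using pos by blast
    \<comment> \<open>Conjugation is a *-homomorphism, so the positivity witness for the pulled-back
      matrix is carried forward by \<open>conj_by u\<close>.\<close>
    have "conj_op u E (mstar X ** X) = mstar (conj_by u Y) ** conj_by u Y"
      by (simp add: conj_op_def conj_by_mult[OF u', symmetric] mstar_conj_by[symmetric] Y)
        (simp add: mstar_conj_by conj_by_mult[OF u])
    then show ?thesis by blast
  qed
  moreover have "Vector_Spaces.linear cscale cscale (conj_op u E)"
    using conj_op_operators[OF lin] by (simp add: operators_def)
  moreover have "trace (conj_op u E X) = trace X" for X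
    by (simp add: conj_op_def trace_conj_by[OF u] trace_conj_by[OF u'] tr)
  ultimately show ?thesis
    unfolding is_cond_exp_def by (auto simp: u id in_C conj_op_def)
qed

lemma jones_eqI: "unital_cstar_subalgebra C \<Longrightarrow> is_cond_exp C E \<Longrightarrow> jones C = E"
  unfolding jones_def by (blast intro: is_cond_exp_unique)

text \<open>Since \<open>jones\<close> is a definite description, some expectation \<open>E\<close>
  must be supplied; its conjugate is then the unique one onto the conjugated algebra.\<close>

lemma jones_conj:
  assumes u: "unitary_matrix u" and C: "unital_cstar_subalgebra C" and E: "is_cond_exp C E"
  shows "jones (conj_by u ` C) = conj_op u (jones C)"
proof -
  have "unital_cstar_subalgebra (conj_by u ` C)"
    using unital_cstar_subalgebra_conj[OF u C] by (simp add: conj_by_def[abs_def])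
  then show ?thesis
    by (simp add: jones_eqI[OF C E] jones_eqI is_cond_exp_conj[OF u E])
qed

text \<open>Multiplying by a diagonal matrix on the left scales rows and on the right scales
  columns; both commute with erasing the off-diagonal entries, which gives the bimodule
  property.\<close>

lemma is_cond_exp_diag:
  "is_cond_exp diag_alg (\<lambda>X :: 'n::finite cmat. \<chi> i j. if i = j then X $ i $ j else 0)"
  (is "is_cond_exp _ ?E")
proof -
  have diag_left: "(A ** X) $ i $ j = A $ i $ i * X $ i $ j"
    if "A \<in> diag_alg" for A X :: "'n cmat" and i j
  proof -
    have *: "A $ i $ k * X $ k $ j = (if k = i then A $ i $ i * X $ i $ j else 0)" for k
      using that by (auto simp: diag_alg_def)
    show ?thesis by (simp add: matrix_matrix_mult_def sum.cong[OF refl *])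
  qed
  have diag_right: "(X ** B) $ i $ j = X $ i $ j * B $ j $ j"
    if "B \<in> diag_alg" for B X :: "'n cmat" and i j
  proof -
    have *: "X $ i $ k * B $ k $ j = (if k = j then X $ i $ j * B $ j $ j else 0)" for k
      using that by (auto simp: diag_alg_def)
    show ?thesis by (simp add: matrix_matrix_mult_def sum.cong[OF refl *])
  qed
  have "?E (A ** X ** B) = A ** ?E X ** B" if "A \<in> diag_alg" "B \<in> diag_alg" for A B X
    using that by (simp add: vec_eq_iff diag_left diag_right)
  moreover have "\<exists>Y. ?E (mstar X ** X) = mstar Y ** Y" for X
  proof -
    \<comment> \<open>The diagonal entries of \<open>mstar X ** X\<close> are the squared norms of
      the columns of \<open>X\<close>; \<open>Y\<close> is the diagonal matrix of those
      norms.\<close>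
    define r where "r i = (\<Sum>k\<in>UNIV. (cmod (X $ k $ i))\<^sup>2)" for i
    define Y :: "'n cmat" where "Y = (\<chi> i j. if i = j then of_real (sqrt (r i)) else 0)"
    have r: "r i \<ge> 0" for i by (simp add: r_def sum_nonneg)
    have "(mstar X ** X) $ i $ i = of_real (r i)" for i
      by (simp add: r_def matrix_matrix_mult_def complex_norm_square mult.commute
          del: of_real_power)
    moreover have "Y \<in> diag_alg" by (simp add: Y_def diag_alg_def)
    then have "(mstar Y ** Y) $ i $ j = (if i = j then of_real (r i) else 0)" for i j
      by (simp add: diag_right) (simp add: Y_def r flip: of_real_mult)
    ultimately have "?E (mstar X ** X) = mstar Y ** Y" by (simp add: vec_eq_iff)
    then show ?thesis by blast
  qed
  moreover have "Vector_Spaces.linear cscale cscale ?E"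
    by (simp add: linear_cscale_iff vec_eq_iff)
  moreover have "?E X \<in> diag_alg" "X \<in> diag_alg \<Longrightarrow> ?E X = X" "trace (?E X) = trace X" for X
    by (auto simp: diag_alg_def vec_eq_iff trace_def)
  ultimately show ?thesis unfolding is_cond_exp_def by blast
qed

section \<open>Adjoints under conjugation\<close>

lemma tau_inner_add_right: "tau_inner X (Y + Z) = tau_inner X Y + tau_inner X Z"
  by (simp add: tau_inner_def matrix_add_ldistrib trace_add add_divide_distrib)

lemma tau_inner_cscale_right: "tau_inner X (cscale c Y) = c * tau_inner X Y"
  by (simp add: tau_inner_def cscale_mult trace_cscale)

lemma tau_inner_conj_by:
  "unitary_matrix u \<Longrightarrow> tau_inner (conj_by u X) (conj_by u Y) = tau_inner X Y"
  by (simp add: tau_inner_def mstar_conj_by conj_by_mult trace_conj_by)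

text \<open>Nondegeneracy of the trace form: test against the difference
  \<open>Y - Z\<close>.\<close>

lemma tau_inner_eqI:
  assumes "\<And>X. tau_inner X Y = tau_inner X Z"
  shows "Y = Z"
proof -
  have "tau_inner (Y - Z) (Y - Z) = 0"
    using tau_inner_add_right[of "Y - Z" "Y - Z" Z] assms[of "Y - Z"] by simp
  then show ?thesis using trace_mstar_self_eq_0[of "Y - Z"] by (simp add: tau_inner_def)
qed

lemma op_star_eqI:
  assumes "S \<in> operators" "\<And>X Y. tau_inner (S X) Y = tau_inner X (T Y)"
  shows "op_star S = T"
  using assms by (intro ext tau_inner_eqI) (metis op_star_adjoint)

text \<open>Linearity of the adjoint is required because \<open>dual_cond_exp\<close> is governed by
  its axioms only on \<open>operators\<close>.\<close>

lemma op_star_operators: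
  assumes S: "S \<in> operators"
  shows "op_star S \<in> operators"
  unfolding operators_def linear_cscale_iff mem_Collect_eq
  by (intro conjI allI tau_inner_eqI)
    (simp_all add: op_star_adjoint[OF S, symmetric] tau_inner_add_right tau_inner_cscale_right)

text \<open>\<open>conj_by u\<close> preserves \<open>tau_inner\<close>, so it can be moved across
  the form before and after taking the adjoint of \<open>S\<close>.\<close>

lemma op_star_conj:
  assumes u: "unitary_matrix u" and S: "S \<in> operators"
  shows "op_star (conj_op u S) = conj_op u (op_star S)"
proof (rule op_star_eqI[OF conj_op_operators[OF S]])
  note u' = unitary_matrix_mstar[OF u]
  fix X Y
  have "tau_inner (conj_op u S X) Y = tau_inner (S (conj_by (mstar u) X)) (conj_by (mstar u) Y)"
    using tau_inner_conj_by[OF u', of "conj_op u S X" Y] by (simp add: conj_op_def u)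
  also have "\<dots> = tau_inner (conj_by (mstar u) X) (op_star S (conj_by (mstar u) Y))"
    by (rule op_star_adjoint[OF S])
  also have "\<dots> = tau_inner X (conj_op u (op_star S) Y)"
    using tau_inner_conj_by[OF u', of X "conj_op u (op_star S) Y"] by (simp add: conj_op_def u)
  finally show "tau_inner (conj_op u S X) Y = tau_inner X (conj_op u (op_star S) Y)" .
qed

section \<open>The dual conditional expectation and the operator inner product\<close>

lemma jones1_conj:
  assumes "unitary_matrix u"
  shows "conj_op u jones1 = jones1"
  using assms unitary_matrix_mstar[OF assms]
  by (simp add: fun_eq_iff conj_op_def jones1_eq trace_conj_by conj_by_mat)

text \<open>Transporting \<open>dual_cond_exp\<close> along the conjugation gives a map
  \<open>F\<close> with the same defining properties, hence the same map on
  \<open>operators\<close>.\<close>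

lemma dual_cond_exp_conj:
  fixes u :: "'n::finite cmat"
  assumes u: "unitary_matrix u" and T: "T \<in> operators"
  shows "dual_cond_exp (conj_op u T) = conj_by u (dual_cond_exp T)"
proof -
  define F where "F = restrict (\<lambda>T. conj_by (mstar u) (dual_cond_exp (conj_op u T))) operators"
  have D: "is_dual_cond_exp (dual_cond_exp :: ('n cmat \<Rightarrow> 'n cmat) \<Rightarrow> 'n cmat)"
    by (rule is_dual_cond_exp_dual_cond_exp)
  note D' = D[unfolded is_dual_cond_exp_def]
  \<comment> \<open>As \<open>jones1\<close> commutes with conjugation, the generator built from
    \<open>x\<close> and \<open>y\<close> becomes the one built from their conjugates.\<close>
  have "conj_op u (\<lambda>X. x ** jones1 (y ** X)) = (\<lambda>X. conj_by u x ** jones1 (conj_by u y ** X))" for x y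
  proof
    fix X
    have "conj_op u (\<lambda>X. x ** jones1 (y ** X)) X =
        conj_by u x ** conj_op u jones1 (conj_by u (y ** conj_by (mstar u) X))"
      by (simp add: conj_op_def u conj_by_mult)
    then show "conj_op u (\<lambda>X. x ** jones1 (y ** X)) X = conj_by u x ** jones1 (conj_by u y ** X)"
      by (simp add: jones1_conj u conj_by_mult[OF u, symmetric])
  qed
  then have "F (\<lambda>X. x ** jones1 (y ** X)) = cscale (1 / (of_nat CARD('n))\<^sup>2) (x ** y)" for x y
    using D' by (simp add: F_def operators_simple conj_by_cscale conj_by_mult[OF u] u)
  moreover have "F (\<lambda>X. S X + T X) = F S + F T" if "S \<in> operators" "T \<in> operators" for S T
  proof -
    have "conj_op u (\<lambda>X. S X + T X) = (\<lambda>X. conj_op u S X + conj_op u T X)"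
      by (simp add: fun_eq_iff conj_op_def conj_by_add)
    then show ?thesis
      using that D' by (simp add: F_def operators_add conj_op_operators conj_by_add)
  qed
  moreover have "F (\<lambda>X. cscale c (T X)) = cscale c (F T)" if "T \<in> operators" for c T
  proof -
    have "conj_op u (\<lambda>X. cscale c (T X)) = (\<lambda>X. cscale c (conj_op u T X))"
      by (simp add: fun_eq_iff conj_op_def conj_by_cscale)
    then show ?thesis
      using that D' by (simp add: F_def operators_scale conj_op_operators conj_by_cscale)
  qed
  ultimately have "is_dual_cond_exp F" by (simp add: is_dual_cond_exp_def F_def)
  \<comment> \<open>Both sides are given by the same explicit sum over matrix units.\<close>
  then have "F T = dual_cond_exp T" by (simp add: is_dual_cond_exp_eq[OF _ T] D)
  then have "conj_by u (dual_cond_exp T) = conj_by u (F T)" by simp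
  then show ?thesis by (simp add: F_def T u)
qed

lemma operators_comp: "S \<in> operators \<Longrightarrow> T \<in> operators \<Longrightarrow> S \<circ> T \<in> operators"
  by (simp add: operators_def linear_cscale_iff)

lemma op_inner_conj:
  assumes "unitary_matrix u" "S \<in> operators" "T \<in> operators"
  shows "op_inner (conj_op u S) (conj_op u T) = conj_by u (op_inner S T)"
  using assms
  by (simp add: op_inner_def op_star_conj conj_op_comp dual_cond_exp_conj operators_comp
      op_star_operators)

section \<open>Unitary invariance of the operator norm\<close>

lemma inner_mstar_right:
  fixes A :: "'n::finite cmat"
  shows "(A *v x) \<bullet> y = x \<bullet> (mstar A *v y)"
proof -
  have "(A *v x) \<bullet> y = (\<Sum>i\<in>UNIV. \<Sum>j\<in>UNIV. (A $ i $ j * x $ j) \<bullet> y $ i)"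
    by (simp add: inner_vec_def matrix_vector_mult_def inner_sum_left)
  \<comment> \<open>The inner product here is the real one on complex numbers, for which
    multiplication by a scalar has multiplication by its conjugate as adjoint.\<close>
  also have "\<dots> = (\<Sum>j\<in>UNIV. \<Sum>i\<in>UNIV. x $ j \<bullet> (cnj (A $ i $ j) * y $ i))"
    by (subst sum.swap) (simp add: inner_complex_def algebra_simps)
  also have "\<dots> = x \<bullet> (mstar A *v y)"
    by (simp add: inner_vec_def matrix_vector_mult_def inner_sum_right)
  finally show ?thesis .
qed

lemma norm_unitary_mult:
  assumes "unitary_matrix u"
  shows "norm (u *v x) = norm x"
  using assms
  by (simp add: norm_eq_sqrt_inner inner_mstar_right matrix_vector_mul_assoc unitary_matrix_def)

text \<open>The operator norm is a supremum of quotients; substituting \<open>mstar u *v x\<close>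
  for the vector, a surjective isometry, turns the quotients for \<open>A\<close> into those for its
  conjugate.\<close>

lemma mnorm_conj:
  assumes u: "unitary_matrix u"
  shows "mnorm (conj_by u A) = mnorm A"
proof -
  note u' = unitary_matrix_mstar[OF u]
  have "surj ((*v) (mstar u))"
    using u' by (intro surjI[of _ "(*v) u"]) (simp add: matrix_vector_mul_assoc unitary_matrix_def mstar_mstar)
  then have "range (\<lambda>x. norm (A *v x) / norm x) = range ((\<lambda>x. norm (A *v x) / norm x) \<circ> (*v) (mstar u))"
    by (metis image_comp)
  also have "(\<lambda>x. norm (A *v x) / norm x) \<circ> (*v) (mstar u) = (\<lambda>x. norm (conj_by u A *v x) / norm x)"
    by (simp add: fun_eq_iff conj_by_def norm_unitary_mult[OF u] norm_unitary_mult[OF u']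
        flip: matrix_vector_mul_assoc)
  finally show ?thesis by (simp add: mnorm_def onorm_def)
qed

section \<open>Invariance of the interior angle\<close>

lemma operators_jones_diff:
  fixes C :: "'n::finite cmat set"
  assumes C: "unital_cstar_subalgebra C" and E: "is_cond_exp C E"
  shows "(\<lambda>X. jones C X - jones1 X) \<in> operators"
proof -
  have "E \<in> operators" using E by (simp add: is_cond_exp_def operators_def)
  moreover have "(jones1 :: 'n cmat \<Rightarrow> 'n cmat) \<in> operators"
    using operators_simple[of "mat 1" "mat 1 :: 'n cmat"] by simp
  ultimately show ?thesis
    unfolding jones_eqI[OF C E]
    by (auto simp: operators_def linear_cscale_iff vec_eq_iff right_diff_distrib)
qed

text \<open>All three operator inner products in the cosine formula are conjugated by
  \<open>u\<close>, so their norms, and hence the descriptions defining the two angles,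
  coincide.\<close>

lemma interior_angle_conj:
  assumes u: "unitary_matrix u"
    and C: "unital_cstar_subalgebra C" "is_cond_exp C E"
    and D: "unital_cstar_subalgebra D" "is_cond_exp D F"
  shows "interior_angle (conj_by u ` C) (conj_by u ` D) = interior_angle C D"
proof -
  have diff: "(\<lambda>X. jones (conj_by u ` B) X - jones1 X) = conj_op u (\<lambda>X. jones B X - jones1 X)"
    if "unital_cstar_subalgebra B" "is_cond_exp B G" for B G
    using fun_cong[OF jones1_conj[OF u]]
    by (simp add: fun_eq_iff jones_conj[OF u that]) (simp add: conj_op_def conj_by_diff)
  show ?thesis
    unfolding interior_angle_def Let_def op_norm_def diff[OF C] diff[OF D]
    by (simp only: op_inner_conj u operators_jones_diff[OF C] operators_jones_diff[OF D] mnorm_conj)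
qed

theorem theorem5p14:
  fixes u v :: "complex ^ 'n ^ 'n"
  assumes "CARD('n) \<ge> 2"
    and "unitary_matrix u" and "unitary_matrix v"
  shows "interior_angle ((\<lambda>d. u ** d ** mstar u) ` diag_alg) ((\<lambda>d. v ** d ** mstar v) ` diag_alg)
       = interior_angle diag_alg ((\<lambda>d. mstar u ** v ** d ** mstar v ** u) ` diag_alg)"
proof -
  note u = assms(2) and w = unitary_matrix_mult[OF unitary_matrix_mstar[OF assms(2)] assms(3)]
  let ?D = "conj_by (mstar u ** v) ` (diag_alg :: 'n cmat set)"
  have "unital_cstar_subalgebra ?D"
    using unital_cstar_subalgebra_conj[OF w unital_cstar_subalgebra_diag] by (simp add: conj_by_def[abs_def])
  then have "interior_angle (conj_by u ` diag_alg) (conj_by u ` ?D) = interior_angle diag_alg ?D"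
    by (rule interior_angle_conj[OF u unital_cstar_subalgebra_diag is_cond_exp_diag _
          is_cond_exp_conj[OF w is_cond_exp_diag]])
  \<comment> \<open>The factor \<open>u\<close> cancels the leading \<open>mstar u\<close> in
    \<open>?D\<close>.\<close>
  moreover have "conj_by u ` ?D = conj_by v ` diag_alg"
    using u by (simp add: image_image conj_by_conj_by[symmetric])
  ultimately show ?thesis
    by (simp add: conj_by_def[abs_def] mstar_mult mstar_mstar matrix_mul_assoc)
qed

end
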